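(* Assume $\sigma''=0$, so that $\sigma'$ is a constant. Let the wave-breaking time $t^*_x$ be the random time defined by $$-\frac12 q_0(x)\int_0^{t^*_x}\exp\big(-\sigma' W(s)\big)\,ds=1 ,$$ and let $$A^{(\mu)}(t):=\int_0^t\exp\big(2\mu s+2W(s)\big)\,ds .$$ Then $$\mathbb{P}\big(\{t^*_x\ge t\}\big)=\mathbb{P}\bigg(\bigg\{A^{(0)}\bigg(\frac{(\sigma')^2t}{4}\bigg)\le\frac{-(\sigma')^2}{2q_0(x)}\bigg\}\bigg).$$
   Context: $W$ is a standard one-dimensional Brownian motion under $\mathbb{P}$; $\sigma:\mathbb{R}\to\mathbb{R}$ is the noise coefficient and $\sigma'$ its derivative; $q_0:\mathbb{R}\to\mathbb{R}$, $q_0\in L^1(\mathbb{R})\cap L^2(\mathbb{R})$, is the initial condition of the stochastic Hunter–Saxton equation $\partial_tq+\partial_x(uq)+\partial_x(\sigma q)\circ\dot W=\frac12q^2$, $\partial_xu=q$, where $\circ$ denotes Stratonovich multiplication. $A^{(0)}$ is $A^{(\mu)}$ with $\mu=0$, and $t\ge0$. The time $t^*_x$, indexed by the Lebesgue points $x$ of $q_0$, is the blow-up (wave-breaking) time of $q$ along the characteristic started at $x$; it is set to $\infty$ if the defining equality never holds.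
   Formalization: Assumes q_0(x)<0 and σ'≠0: for q_0(x)>0, σ'≠0 the left side is 1 and the right side 0; for q_0(x)=0 the quotient is undefined; for σ'=0, q_0(x)<0 the identity fails when t>-2/q_0(x). All Brownian paths are taken continuous. *)

theory Defs
  imports "HOL-Probability.Probability"
begin

text \<open>
  The time index of a process is a real number, but only times \<open>t \<ge> 0\<close> are constrained.
  Every path is continuous; almost surely continuous paths would
  require a complete \<open>M\<close> for path functionals to be measurable.
\<close>

locale standard_brownian_motion = prob_space M
  for M :: "'a measure" and W :: "real \<Rightarrow> 'a \<Rightarrow> real" +
  assumes random_variable: "\<And>t. 0 \<le> t \<Longrightarrow> W t \<in> borel_measurable M"
    and starts_at_zero: "AE \<omega> in M. W 0 \<omega> = 0"
    and independent_increments: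
      "\<And>(n :: nat) ts. 0 \<le> ts 0 \<Longrightarrow> (\<And>i. i < n \<Longrightarrow> ts i < ts (Suc i)) \<Longrightarrow>
        indep_vars (\<lambda>_. borel) (\<lambda>i \<omega>. W (ts (Suc i)) \<omega> - W (ts i) \<omega>) {..<n}"
    and normal_increments:
      "\<And>s t. 0 \<le> s \<Longrightarrow> s < t \<Longrightarrow>
        distributed M lborel (\<lambda>\<omega>. W t \<omega> - W s \<omega>) (normal_density 0 (sqrt (t - s)))"
    and continuous_paths: "\<And>\<omega>. \<omega> \<in> space M \<Longrightarrow> continuous_on {0..} (\<lambda>t. W t \<omega>)"

definition lebesgue_point :: "(real \<Rightarrow> real) \<Rightarrow> real \<Rightarrow> bool" where
  "lebesgue_point f x \<longleftrightarrow>
    ((\<lambda>r. (LINT y:{x - r..x + r}|lebesgue. \<bar>f y - f x\<bar>) / (2 * r)) \<longlongrightarrow> 0) (at_right 0)"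

text \<open>
  The argument \<open>c\<close> is the constant value of the derivative of the noise coefficient.
  For \<open>\<omega>\<close> with a continuous path the integral is strictly increasing in its upper limit, so
  at most one time satisfies the defining equality.
\<close>

definition wave_breaking_time ::
    "(real \<Rightarrow> real) \<Rightarrow> real \<Rightarrow> (real \<Rightarrow> 'a \<Rightarrow> real) \<Rightarrow> real \<Rightarrow> 'a \<Rightarrow> ereal" where
  "wave_breaking_time q\<^sub>0 c W x \<omega> =
    (let breaks = (\<lambda>\<tau>. 0 \<le> \<tau> \<and> - (1 / 2) * q\<^sub>0 x * (LBINT s:{0..\<tau>}. exp (- c * W s \<omega>)) = 1)
     in if \<exists>\<tau>. breaks \<tau> then ereal (THE \<tau>. breaks \<tau>) else \<infinity>)"

definition exp_functional :: "(real \<Rightarrow> 'a \<Rightarrow> real) \<Rightarrow> real \<Rightarrow> real \<Rightarrow> 'a \<Rightarrow> real" where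
  "exp_functional W \<mu> t \<omega> = (LBINT s:{0..t}. exp (2 * \<mu> * s + 2 * W s \<omega>))"

end

theory Submission imports Defs begin

text \<open>
  Since \<open>\<tau> \<mapsto> \<integral>\<^sub>0\<^sup>\<tau> exp (- c W s) ds\<close> is continuous, strictly increasing and zero at the origin,
  wave breaking does not occur before \<open>t\<close> precisely when its value at \<open>t\<close> has not exceeded the
  threshold \<open>- 2 / q\<^sub>0 x\<close> (\<open>wave_breaking_time_ge_iff\<close>). What remains is to compare this random
  variable with the exponential functional, and this is Brownian scaling: the process
  \<open>B s = (- c / 2) W (4 s / c\<^sup>2)\<close> is again a Brownian motion (\<open>brownian_scaling\<close>), it satisfies
  \<open>- c W u = 2 B (c\<^sup>2 u / 4)\<close>, and the substitution \<open>s = c\<^sup>2 u / 4\<close> turns the integral into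
  \<open>4 / c\<^sup>2\<close> times the exponential functional of \<open>B\<close> at time \<open>c\<^sup>2 t / 4\<close>. The wave-breaking event
  is therefore, path by path, the event on the right-hand side with \<open>B\<close> in place of \<open>W\<close>.

  Passing from \<open>B\<close> back to \<open>W\<close> requires that the law of \<open>\<integral>\<^sub>0\<^sup>T f (W s) ds\<close>, \<open>f\<close> continuous, is the same for all
  Brownian motions (\<open>time_integral_law\<close>). The axioms of Brownian motion only determine the joint law
  of finitely many increments, so the integral is written as a pointwise limit of Riemann sums. Each
  sum is a fixed measurable function of independent normal increments, hence its characteristic
  function depends on the partition alone; dominated convergence carries this over to the limit and
  a characteristic function determines the law.
\<close>

section \<open>Integrals of a continuous function over initial segments\<close>

lemma set_integral_singleton:
  fixes f :: "real \<Rightarrow> real"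
  shows "(LBINT s:{a..a}. f s) = 0"
  unfolding set_lebesgue_integral_def
proof (rule integral_eq_zero_AE)
  show "AE s in lborel. indicator {a..a} s *\<^sub>R f s = 0"
    using AE_lborel_singleton[of a] by eventually_elim simp
qed

text \<open>
  Both the monotonicity of the integral in its upper limit and the error estimate for Riemann sums
  are read off from this form of the mean value theorem.
\<close>

lemma set_integral_mean_value:
  fixes f :: "real \<Rightarrow> real"
  assumes f: "continuous_on {0..} f" and ab: "0 \<le> a" "a < b"
  obtains z where "a < z" "z < b"
    "(LBINT s:{0..b}. f s) - (LBINT s:{0..a}. f s) = (b - a) * f z"
proof -
  have eq: "(LBINT s:{0..u}. f s) = integral {0..u} f" for u
    by (intro set_borel_integral_eq_integral borel_integrable_atLeastAtMost'
        continuous_on_subset[OF f]) auto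
  have "((\<lambda>u. integral {0..u} f) has_real_derivative f y) (at y)" if "a < y" "y < b" for y
  proof -
    have "((\<lambda>u. integral {0..u} f) has_real_derivative f y) (at y within {0..b})"
      using that ab by (intro integral_has_real_derivative continuous_on_subset[OF f]) auto
    then show ?thesis
      using that ab by (simp add: at_within_Icc_at)
  qed
  moreover have "continuous_on {a..b} (\<lambda>u. integral {0..u} f)"
    using ab by (intro continuous_on_subset[where s = "{0..b}" and t = "{a..b}"]
        indefinite_integral_continuous_1 integrable_continuous_interval continuous_on_subset[OF f]) auto
  ultimately obtain l z where z: "a < z" "z < b" "DERIV (\<lambda>u. integral {0..u} f) z :> l"
      "integral {0..b} f - integral {0..a} f = (b - a) * l"
    and "l = f z"
    using MVT[of a b "\<lambda>u. integral {0..u} f"] ab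
    by (metis DERIV_unique real_differentiable_def)
  then show thesis
    using that[of z] by (simp add: eq)
qed

text \<open>
  By the mean value theorem, each summand differs from the integral over its cell by at most the
  length of the cell times the oscillation of \<open>f\<close> there, and uniform continuity makes the
  oscillation small on all cells at once.
\<close>

lemma right_riemann_sums_tendsto:
  fixes f :: "real \<Rightarrow> real"
  assumes f: "continuous_on {0..} f" and T: "0 < T"
  shows "(\<lambda>n. T / real (Suc n) * (\<Sum>k<Suc n. f (T * real (Suc k) / real (Suc n))))
    \<longlonglongrightarrow> (LBINT s:{0..T}. f s)"
proof (rule LIMSEQ_I)
  fix e :: real assume e: "0 < e"
  have "uniformly_continuous_on {0..T} f"
    by (intro compact_uniformly_continuous continuous_on_subset[OF f]) auto
  then obtain d where d: "0 < d" and
    fd: "\<And>x y. x \<in> {0..T} \<Longrightarrow> y \<in> {0..T} \<Longrightarrow> dist y x < d \<Longrightarrow> dist (f y) (f x) < e / (2 * T)"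
    using e T unfolding uniformly_continuous_on_def
    by (metis mult_pos_pos zero_less_divide_iff zero_less_numeral)
  obtain N where N: "T / d < real N" using reals_Archimedean2 by blast
  show "\<exists>no. \<forall>n\<ge>no. norm (T / real (Suc n) * (\<Sum>k<Suc n. f (T * real (Suc k) / real (Suc n)))
      - (LBINT s:{0..T}. f s)) < e"
  proof (intro exI[of _ N] allI impI)
    fix n assume n: "N \<le> n"
    define h where "h = T / real (Suc n)"
    define F where "F = (\<lambda>u. LBINT s:{0..u}. f s)"
    define p where "p = (\<lambda>k. T * real k / real (Suc n))"
    have h: "0 < h" using T by (simp add: h_def)
    have hd: "h < d"
    proof -
      have "T / d < real (Suc n)" using N n by linarith
      then show ?thesis using d by (simp add: h_def field_simps)
    qed
    have p: "p (Suc k) - p k = h" "0 \<le> p k" for k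
      using T by (simp_all add: p_def h_def ring_distribs add_divide_distrib)
    have pT: "p (Suc k) \<le> T" if "k < Suc n" for k
    proof -
      have "real (Suc k) \<le> real (Suc n)" using that by (intro of_nat_mono) simp
      then have "T * real (Suc k) \<le> T * real (Suc n)" using T by (intro mult_left_mono) auto
      then show ?thesis unfolding p_def by (subst pos_divide_le_eq) auto
    qed
    have cell: "\<bar>h * f (p (Suc k)) - (F (p (Suc k)) - F (p k))\<bar> \<le> h * (e / (2 * T))"
      if k: "k < Suc n" for k
    proof -
      have "p k < p (Suc k)" using p(1)[of k] h by linarith
      then obtain z where z: "p k < z" "z < p (Suc k)"
        and Fz: "F (p (Suc k)) - F (p k) = (p (Suc k) - p k) * f z"
        unfolding F_def using set_integral_mean_value[OF f p(2)[of k]] by blast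
      have "dist (f (p (Suc k))) (f z) < e / (2 * T)"
        using z pT[OF k] p(2)[of k] p(1)[of k] hd by (intro fd) (auto simp: dist_real_def)
      then have "\<bar>f (p (Suc k)) - f z\<bar> \<le> e / (2 * T)" by (simp add: dist_real_def)
      then have "h * \<bar>f (p (Suc k)) - f z\<bar> \<le> h * (e / (2 * T))"
        using h by (intro mult_left_mono) auto
      moreover have "h * f (p (Suc k)) - (F (p (Suc k)) - F (p k)) = h * (f (p (Suc k)) - f z)"
        by (simp add: Fz p(1) algebra_simps)
      ultimately show ?thesis using h by (simp add: abs_mult)
    qed
    have "(\<Sum>k<Suc n. F (p (Suc k)) - F (p k)) = F (p (Suc n)) - F (p 0)"
      by (rule sum_lessThan_telescope)
    also have "\<dots> = F T"
      using nonzero_mult_div_cancel_right[of "real (Suc n)" T]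
      by (simp del: of_nat_Suc atLeastAtMost_singleton add: F_def p_def set_integral_singleton)
    finally have FT: "F T = (\<Sum>k<Suc n. F (p (Suc k)) - F (p k))" ..
    have "\<bar>h * (\<Sum>k<Suc n. f (p (Suc k))) - F T\<bar>
        = \<bar>\<Sum>k<Suc n. h * f (p (Suc k)) - (F (p (Suc k)) - F (p k))\<bar>"
      unfolding FT sum_distrib_left sum_subtractf[symmetric] ..
    also have "\<dots> \<le> (\<Sum>k<Suc n. \<bar>h * f (p (Suc k)) - (F (p (Suc k)) - F (p k))\<bar>)"
      by (rule sum_abs)
    also have "\<dots> \<le> (\<Sum>k<Suc n. h * (e / (2 * T)))"
      by (intro sum_mono cell) auto
    also have "\<dots> = real (Suc n) * (h * (e / (2 * T)))"
      by simp
    also have "\<dots> = e / 2"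
      using T by (simp add: h_def del: of_nat_Suc)
    also have "\<dots> < e" using e by simp
    finally show "norm (T / real (Suc n) * (\<Sum>k<Suc n. f (T * real (Suc k) / real (Suc n)))
      - (LBINT s:{0..T}. f s)) < e"
      by (simp add: h_def F_def p_def)
  qed
qed

lemma set_integral_rescale:
  fixes f :: "real \<Rightarrow> real"
  assumes "0 < a"
  shows "(LBINT s:{0..a * t}. f (s / a)) = a * (LBINT u:{0..t}. f u)"
proof -
  have "(LBINT s:{0..a * t}. f (s / a))
      = a * (LINT u|lborel. indicator {0..a * t} (a * u) *\<^sub>R f (a * u / a))"
    unfolding set_lebesgue_integral_def
    using assms lborel_integral_real_affine[of a "\<lambda>s. indicator {0..a * t} s *\<^sub>R f (s / a)" 0]
    by simp
  also have "(\<lambda>u. indicator {0..a * t} (a * u) *\<^sub>R f (a * u / a)) = (\<lambda>u. indicator {0..t} u *\<^sub>R f u)"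
    using assms by (auto simp: fun_eq_iff indicator_def zero_le_mult_iff)
  finally show ?thesis
    by (simp add: set_lebesgue_integral_def)
qed

section \<open>The wave-breaking event in terms of the path\<close>

text \<open>
  If the integral reaches the critical value \<open>- 2 / q\<^sub>0 x\<close>, strict monotonicity makes the breaking
  time unique and lets it be compared with \<open>t\<close> through the values of the integral. If it never
  reaches that value, it stays below it by the intermediate value theorem. A path that breaks
  exactly at \<open>t\<close> belongs to both sides, so both inequalities are weak.
\<close>

lemma wave_breaking_time_ge_iff:
  assumes W: "continuous_on {0..} (\<lambda>s. W s \<omega>)" and q: "q\<^sub>0 x < 0" and t: "0 \<le> t"
  shows "ereal t \<le> wave_breaking_time q\<^sub>0 c W x \<omega> \<longleftrightarrow>
    (LBINT s:{0..t}. exp (- c * W s \<omega>)) \<le> - 2 / q\<^sub>0 x"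
proof -
  define I where "I = (\<lambda>\<tau>. LBINT s:{0..\<tau>}. exp (- c * W s \<omega>))"
  define K where "K = - 2 / q\<^sub>0 x"
  have cont: "continuous_on {0..} (\<lambda>s. exp (- c * W s \<omega>))"
    by (intro continuous_intros W)
  have mono: "I a < I b" if ab: "0 \<le> a" "a < b" for a b
  proof -
    obtain z where "I b - I a = (b - a) * exp (- c * W z \<omega>)"
      unfolding I_def by (rule set_integral_mean_value[OF cont ab])
    moreover have "0 < (b - a) * exp (- c * W z \<omega>)" using ab by simp
    ultimately show ?thesis by linarith
  qed
  have le_iff: "I a \<le> I b \<longleftrightarrow> a \<le> b" if "0 \<le> a" "0 \<le> b" for a b
    using mono[of a b] mono[of b a] that by (cases a b rule: linorder_cases) auto
  have I0: "I 0 = 0"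
    by (simp only: I_def set_integral_singleton)
  have "0 < K" using q by (simp add: K_def)
  have breaks: "(0 \<le> \<tau> \<and> - (1 / 2) * q\<^sub>0 x * (LBINT s:{0..\<tau>}. exp (- c * W s \<omega>)) = 1)
      \<longleftrightarrow> 0 \<le> \<tau> \<and> I \<tau> = K" for \<tau>
    using q by (auto simp: I_def K_def field_simps)
  show ?thesis
  proof (cases "\<exists>\<tau>. 0 \<le> \<tau> \<and> I \<tau> = K")
    case True
    then obtain \<tau> where \<tau>: "0 \<le> \<tau>" "I \<tau> = K" by blast
    have "(THE \<tau>. 0 \<le> \<tau> \<and> I \<tau> = K) = \<tau>"
    proof (rule the_equality)
      fix \<rho> assume \<rho>: "0 \<le> \<rho> \<and> I \<rho> = K"
      then show "\<rho> = \<tau>"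
        using le_iff[of \<rho> \<tau>] le_iff[of \<tau> \<rho>] \<tau> by simp
    qed (use \<tau> in simp)
    then have "wave_breaking_time q\<^sub>0 c W x \<omega> = ereal \<tau>"
      using True unfolding wave_breaking_time_def breaks Let_def by simp
    then show ?thesis
      using le_iff[OF t \<tau>(1)] \<tau>(2) by (simp add: I_def K_def)
  next
    case False
    then have "wave_breaking_time q\<^sub>0 c W x \<omega> = \<infinity>"
      unfolding wave_breaking_time_def breaks Let_def by simp
    moreover have "I t \<le> K"
    proof (rule ccontr)
      assume "\<not> I t \<le> K"
      moreover have "continuous_on {0..t} I"
      proof -
        have "continuous_on {0..t} (\<lambda>s. exp (- c * W s \<omega>))"
          by (rule continuous_on_subset[OF cont]) auto
        then have "continuous_on {0..t} (\<lambda>\<tau>. integral {0..\<tau>} (\<lambda>s. exp (- c * W s \<omega>)))"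
          by (intro indefinite_integral_continuous_1 integrable_continuous_interval)
        moreover have "I \<tau> = integral {0..\<tau>} (\<lambda>s. exp (- c * W s \<omega>))" for \<tau>
          unfolding I_def by (intro set_borel_integral_eq_integral
              borel_integrable_atLeastAtMost' continuous_on_subset[OF cont]) auto
        ultimately show ?thesis by simp
      qed
      ultimately obtain \<tau> where "0 \<le> \<tau>" "I \<tau> = K"
        using IVT'[of I 0 K t] I0 \<open>0 < K\<close> t by auto
      then show False using False by blast
    qed
    ultimately show ?thesis by (simp add: I_def K_def)
  qed
qed

section \<open>Brownian scaling\<close>

lemma brownian_scaling:
  assumes "standard_brownian_motion M W" and a: "a \<noteq> 0"
  shows "standard_brownian_motion M (\<lambda>s \<omega>. a * W (s / a\<^sup>2) \<omega>)"
proof -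
  interpret standard_brownian_motion M W by fact
  have a2: "0 < a\<^sup>2" using a by simp
  show ?thesis
  proof
    fix t :: real assume "0 \<le> t"
    then show "(\<lambda>\<omega>. a * W (t / a\<^sup>2) \<omega>) \<in> borel_measurable M"
      by (intro borel_measurable_times random_variable) auto
  next
    show "AE \<omega> in M. a * W (0 / a\<^sup>2) \<omega> = 0"
      using starts_at_zero by simp
  next
    fix n :: nat and ts :: "nat \<Rightarrow> real"
    assume "0 \<le> ts 0" "\<And>i. i < n \<Longrightarrow> ts i < ts (Suc i)"
    then have "indep_vars (\<lambda>_. borel)
        (\<lambda>i \<omega>. W (ts (Suc i) / a\<^sup>2) \<omega> - W (ts i / a\<^sup>2) \<omega>) {..<n}"
      using a2 by (intro independent_increments[where ts = "\<lambda>i. ts i / a\<^sup>2"])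
        (auto intro: divide_strict_right_mono)
    then have "indep_vars (\<lambda>_. borel)
        (\<lambda>i \<omega>. a * (W (ts (Suc i) / a\<^sup>2) \<omega> - W (ts i / a\<^sup>2) \<omega>)) {..<n}"
      by (rule indep_vars_compose2[where Y = "\<lambda>_ y. a * y"]) simp
    then show "indep_vars (\<lambda>_. borel)
        (\<lambda>i \<omega>. a * W (ts (Suc i) / a\<^sup>2) \<omega> - a * W (ts i / a\<^sup>2) \<omega>) {..<n}"
      by (simp add: right_diff_distrib)
  next
    fix s t :: real assume st: "0 \<le> s" "s < t"
    then have lt: "s / a\<^sup>2 < t / a\<^sup>2"
      using a2 by (simp add: divide_strict_right_mono)
    have "\<bar>a\<bar> * sqrt (t / a\<^sup>2 - s / a\<^sup>2) = sqrt (t - s)"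
      using a by (simp add: diff_divide_distrib[symmetric] real_sqrt_divide)
    moreover have "distributed M lborel (\<lambda>\<omega>. 0 + a * (W (t / a\<^sup>2) \<omega> - W (s / a\<^sup>2) \<omega>))
        (normal_density (0 + a * 0) (\<bar>a\<bar> * sqrt (t / a\<^sup>2 - s / a\<^sup>2)))"
      using st lt a by (intro normal_density_affine normal_increments) auto
    ultimately show "distributed M lborel (\<lambda>\<omega>. a * W (t / a\<^sup>2) \<omega> - a * W (s / a\<^sup>2) \<omega>)
        (normal_density 0 (sqrt (t - s)))"
      by (simp add: right_diff_distrib)
  next
    fix \<omega> assume "\<omega> \<in> space M"
    then have "continuous_on {0..} (\<lambda>s. W (s / a\<^sup>2) \<omega>)"
      by (intro continuous_on_compose2[OF continuous_paths] continuous_intros) (use a in auto)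
    then show "continuous_on {0..} (\<lambda>s. a * W (s / a\<^sup>2) \<omega>)"
      by (intro continuous_intros)
  qed
qed

section \<open>Law of a time integral of Brownian motion\<close>

lemma increasing_times_nonneg:
  fixes ts :: "nat \<Rightarrow> real"
  assumes "0 \<le> ts 0" "\<And>i. i < n \<Longrightarrow> ts i < ts (Suc i)" and "i \<le> n"
  shows "0 \<le> ts i"
  using \<open>i \<le> n\<close>
proof (induction i)
  case (Suc i)
  then show ?case using assms(2)[of i] by simp
qed (use assms(1) in simp)

lemma (in standard_brownian_motion) increments_law:
  assumes "0 \<le> ts 0" "\<And>i. i < Suc n \<Longrightarrow> ts i < ts (Suc i)"
  shows "distr M (\<Pi>\<^sub>M i\<in>{..<Suc n}. borel) (\<lambda>\<omega>. \<lambda>i\<in>{..<Suc n}. W (ts (Suc i)) \<omega> - W (ts i) \<omega>)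
    = (\<Pi>\<^sub>M i\<in>{..<Suc n}. density lborel (normal_density 0 (sqrt (ts (Suc i) - ts i))))"
proof -
  have nonneg: "0 \<le> ts i" if "i \<le> Suc n" for i
    using increasing_times_nonneg[of ts "Suc n" i] assms that by blast
  have rv: "(\<lambda>\<omega>. W (ts (Suc i)) \<omega> - W (ts i) \<omega>) \<in> borel_measurable M" if "i \<in> {..<Suc n}" for i
    using that by (intro borel_measurable_diff random_variable nonneg) auto
  have "distr M (\<Pi>\<^sub>M i\<in>{..<Suc n}. borel) (\<lambda>\<omega>. \<lambda>i\<in>{..<Suc n}. W (ts (Suc i)) \<omega> - W (ts i) \<omega>)
      = (\<Pi>\<^sub>M i\<in>{..<Suc n}. distr M borel (\<lambda>\<omega>. W (ts (Suc i)) \<omega> - W (ts i) \<omega>))"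
  proof (rule indep_vars_iff_distr_eq_PiM'[THEN iffD1, OF _ rv])
    show "indep_vars (\<lambda>_. borel) (\<lambda>i \<omega>. W (ts (Suc i)) \<omega> - W (ts i) \<omega>) {..<Suc n}"
      by (rule independent_increments[OF assms])
  qed auto
  also have "\<dots> = (\<Pi>\<^sub>M i\<in>{..<Suc n}. density lborel (normal_density 0 (sqrt (ts (Suc i) - ts i))))"
  proof (rule PiM_cong)
    fix i assume i: "i \<in> {..<Suc n}"
    then have "distributed M lborel (\<lambda>\<omega>. W (ts (Suc i)) \<omega> - W (ts i) \<omega>)
        (normal_density 0 (sqrt (ts (Suc i) - ts i)))"
      by (intro normal_increments nonneg assms(2)) auto
    from distributed_distr_eq_density[OF this]
    show "distr M borel (\<lambda>\<omega>. W (ts (Suc i)) \<omega> - W (ts i) \<omega>)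
        = density lborel (normal_density 0 (sqrt (ts (Suc i) - ts i)))"
      by (simp cong: distr_cong)
  qed simp
  finally show ?thesis .
qed

text \<open>
  Almost surely \<open>W\<close> starts at zero, so its value at a partition point is the sum of the preceding
  increments; the right-hand side mentions the partition but not the process.
\<close>

lemma (in standard_brownian_motion) finite_functional_law:
  fixes g :: "(nat \<Rightarrow> real) \<Rightarrow> real"
  assumes ts: "ts 0 = 0" "\<And>i. i < Suc n \<Longrightarrow> ts i < ts (Suc i)"
    and g: "g \<in> borel_measurable (\<Pi>\<^sub>M i\<in>{..<Suc n}. borel)"
  shows "distr M borel (\<lambda>\<omega>. g (\<lambda>k\<in>{..<Suc n}. W (ts (Suc k)) \<omega>))
    = distr (\<Pi>\<^sub>M i\<in>{..<Suc n}. density lborel (normal_density 0 (sqrt (ts (Suc i) - ts i)))) borel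
        (\<lambda>d. g (\<lambda>k\<in>{..<Suc n}. \<Sum>i\<le>k. d i))"
proof -
  let ?P = "\<Pi>\<^sub>M i\<in>{..<Suc n}. (borel :: real measure)"
  define D where "D = (\<lambda>\<omega>. \<lambda>i\<in>{..<Suc n}. W (ts (Suc i)) \<omega> - W (ts i) \<omega>)"
  define G where "G = (\<lambda>d :: nat \<Rightarrow> real. g (\<lambda>k\<in>{..<Suc n}. \<Sum>i\<le>k. d i))"
  have nonneg: "0 \<le> ts i" if "i \<le> Suc n" for i
    using increasing_times_nonneg[of ts "Suc n" i] ts that by simp
  have rv: "W (ts i) \<in> borel_measurable M" if "i \<le> Suc n" for i
    using that by (intro random_variable nonneg)
  have D: "D \<in> measurable M ?P"
    unfolding D_def by (intro measurable_restrict borel_measurable_diff rv) auto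
  have G: "G \<in> borel_measurable ?P"
    unfolding G_def
    by (intro measurable_compose[OF _ g] measurable_restrict borel_measurable_sum
        measurable_component_singleton) auto
  have "distr M borel (\<lambda>\<omega>. g (\<lambda>k\<in>{..<Suc n}. W (ts (Suc k)) \<omega>)) = distr M borel (\<lambda>\<omega>. G (D \<omega>))"
  proof (rule distr_cong_AE)
    show "AE \<omega> in M. g (\<lambda>k\<in>{..<Suc n}. W (ts (Suc k)) \<omega>) = G (D \<omega>)"
      using starts_at_zero
    proof eventually_elim
      case (elim \<omega>)
      have "(\<Sum>i\<le>k. D \<omega> i) = W (ts (Suc k)) \<omega>" if "k \<in> {..<Suc n}" for k
      proof -
        have "(\<Sum>i\<le>k. D \<omega> i) = (\<Sum>i<Suc k. W (ts (Suc i)) \<omega> - W (ts i) \<omega>)"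
          using that by (intro sum.cong) (auto simp: D_def)
        also have "\<dots> = W (ts (Suc k)) \<omega> - W (ts 0) \<omega>"
          by (rule sum_lessThan_telescope)
        finally show ?thesis using elim ts(1) by simp
      qed
      then have "(\<lambda>k\<in>{..<Suc n}. \<Sum>i\<le>k. D \<omega> i) = (\<lambda>k\<in>{..<Suc n}. W (ts (Suc k)) \<omega>)"
        by (intro restrict_ext) auto
      then show ?case by (simp add: G_def)
    qed
    show "(\<lambda>\<omega>. g (\<lambda>k\<in>{..<Suc n}. W (ts (Suc k)) \<omega>)) \<in> borel_measurable M"
      by (intro measurable_compose[OF _ g] measurable_restrict rv) auto
    show "(\<lambda>\<omega>. G (D \<omega>)) \<in> borel_measurable M"
      by (rule measurable_compose[OF D G])
  qed auto
  also have "\<dots> = distr (distr M ?P D) borel G"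
    using distr_distr[OF G D] by (simp add: comp_def)
  also have "distr M ?P D
      = (\<Pi>\<^sub>M i\<in>{..<Suc n}. density lborel (normal_density 0 (sqrt (ts (Suc i) - ts i))))"
    unfolding D_def using ts by (intro increments_law) auto
  finally show ?thesis
    unfolding G_def .
qed

lemma (in prob_space) tendsto_char_distr:
  assumes "\<And>n. R n \<in> borel_measurable M" "S \<in> borel_measurable M"
    and lim: "\<And>\<omega>. \<omega> \<in> space M \<Longrightarrow> (\<lambda>n. R n \<omega>) \<longlonglongrightarrow> S \<omega>"
  shows "(\<lambda>n. char (distr M borel (R n)) u) \<longlonglongrightarrow> char (distr M borel S) u"
proof -
  note [measurable] = assms(1,2)
  have "(\<lambda>n. CLINT \<omega>|M. iexp (u * R n \<omega>)) \<longlonglongrightarrow> (CLINT \<omega>|M. iexp (u * S \<omega>))"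
    by (rule integral_dominated_convergence[where w = "\<lambda>_. 1"])
      (auto intro!: tendsto_intros lim simp del: of_real_mult)
  then show ?thesis
    by (simp add: char_def integral_distr)
qed


text \<open>
  The characteristic functions in the limit are those of right Riemann sums on the uniform
  partition. They are stated through the normal increments, without \<open>W\<close>, so that the same
  sequence serves every Brownian motion.
\<close>

lemma (in standard_brownian_motion) time_integral_approx:
  fixes f :: "real \<Rightarrow> real" and T :: real
  defines "ts \<equiv> \<lambda>n k. T * real k / real (Suc n)"
  defines "g \<equiv> \<lambda>n (y :: nat \<Rightarrow> real). T / real (Suc n) * (\<Sum>k<Suc n. f (y k))"
  assumes f: "continuous_on UNIV f" and T: "0 < T"
  shows time_integral_measurable: "(\<lambda>\<omega>. LBINT s:{0..T}. f (W s \<omega>)) \<in> borel_measurable M"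
    and time_integral_char:
      "(\<lambda>n. char (distr (\<Pi>\<^sub>M i\<in>{..<Suc n}.
            density lborel (normal_density 0 (sqrt (ts n (Suc i) - ts n i)))) borel
          (\<lambda>d. g n (\<lambda>k\<in>{..<Suc n}. \<Sum>i\<le>k. d i))) u)
        \<longlonglongrightarrow> char (distr M borel (\<lambda>\<omega>. LBINT s:{0..T}. f (W s \<omega>))) u"
proof -
  define R where "R = (\<lambda>n \<omega>. g n (\<lambda>k\<in>{..<Suc n}. W (ts n (Suc k)) \<omega>))"
  have fm: "f \<in> borel_measurable borel"
    using f by (rule borel_measurable_continuous_onI)
  have g: "g n \<in> borel_measurable (\<Pi>\<^sub>M i\<in>{..<Suc n}. borel)" for n
    unfolding g_def
    by (intro borel_measurable_times borel_measurable_const borel_measurable_sum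
        measurable_compose[OF _ fm] measurable_component_singleton) auto
  have ts: "ts n 0 = 0" "ts n i < ts n (Suc i)" "0 \<le> ts n i" for n i
    using T by (auto simp: ts_def divide_strict_right_mono)
  have R: "R n \<in> borel_measurable M" for n
    unfolding R_def
    by (intro measurable_compose[OF _ g] measurable_restrict random_variable ts)
  have lim: "(\<lambda>n. R n \<omega>) \<longlonglongrightarrow> (LBINT s:{0..T}. f (W s \<omega>))" if "\<omega> \<in> space M" for \<omega>
  proof -
    have "continuous_on {0..} (\<lambda>s. f (W s \<omega>))"
      using that by (intro continuous_on_compose2[OF f continuous_paths]) auto
    from right_riemann_sums_tendsto[OF this T] show ?thesis
      by (simp add: R_def g_def ts_def)
  qed
  show S: "(\<lambda>\<omega>. LBINT s:{0..T}. f (W s \<omega>)) \<in> borel_measurable M"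
    by (rule borel_measurable_LIMSEQ_real[OF lim R])
  have "distr M borel (R n) = distr (\<Pi>\<^sub>M i\<in>{..<Suc n}.
            density lborel (normal_density 0 (sqrt (ts n (Suc i) - ts n i)))) borel
          (\<lambda>d. g n (\<lambda>k\<in>{..<Suc n}. \<Sum>i\<le>k. d i))" for n
    unfolding R_def by (intro finite_functional_law g ts)
  then show "(\<lambda>n. char (distr (\<Pi>\<^sub>M i\<in>{..<Suc n}.
            density lborel (normal_density 0 (sqrt (ts n (Suc i) - ts n i)))) borel
          (\<lambda>d. g n (\<lambda>k\<in>{..<Suc n}. \<Sum>i\<le>k. d i))) u)
        \<longlonglongrightarrow> char (distr M borel (\<lambda>\<omega>. LBINT s:{0..T}. f (W s \<omega>))) u"
    using tendsto_char_distr[OF R S lim, of u] by simp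
qed

lemma time_integral_law:
  fixes f :: "real \<Rightarrow> real"
  assumes V: "standard_brownian_motion M V" and W: "standard_brownian_motion N W"
    and f: "continuous_on UNIV f" and T: "0 < T"
  shows "distr M borel (\<lambda>\<omega>. LBINT s:{0..T}. f (V s \<omega>))
    = distr N borel (\<lambda>\<omega>. LBINT s:{0..T}. f (W s \<omega>))"
proof -
  interpret V: standard_brownian_motion M V by (rule V)
  interpret W: standard_brownian_motion N W by (rule W)
  show ?thesis
  proof (rule Levy_uniqueness)
    show "char (distr M borel (\<lambda>\<omega>. LBINT s:{0..T}. f (V s \<omega>)))
        = char (distr N borel (\<lambda>\<omega>. LBINT s:{0..T}. f (W s \<omega>)))"
      by (rule ext) (rule LIMSEQ_unique[OF V.time_integral_char[OF f T]
            W.time_integral_char[OF f T]])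
  qed (intro V.real_distribution_distr W.real_distribution_distr
      V.time_integral_measurable W.time_integral_measurable f T)+
qed

section \<open>Law of the wave-breaking time\<close>

theorem proposition4p1:
  fixes M :: "'a measure" and W :: "real \<Rightarrow> 'a \<Rightarrow> real"
    and \<sigma> q\<^sub>0 :: "real \<Rightarrow> real" and c x t :: real
  assumes "standard_brownian_motion M W"
    and "\<And>y. \<sigma> differentiable at y"
    and "\<And>y. (deriv \<sigma> has_real_derivative 0) (at y)"
    and "\<And>y. deriv \<sigma> y = c"
    and "c \<noteq> 0"
    and "integrable lebesgue q\<^sub>0"
    and "integrable lebesgue (\<lambda>y. (q\<^sub>0 y)\<^sup>2)"
    and "lebesgue_point q\<^sub>0 x"
    and "q\<^sub>0 x < 0"
    and "0 \<le> t"
  shows "measure M {\<omega> \<in> space M. wave_breaking_time q\<^sub>0 c W x \<omega> \<ge> ereal t} =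
    measure M {\<omega> \<in> space M. exp_functional W 0 (c\<^sup>2 * t / 4) \<omega> \<le> - c\<^sup>2 / (2 * q\<^sub>0 x)}"
proof -
  interpret W: standard_brownian_motion M W by fact
  note c = \<open>c \<noteq> 0\<close>
  define T where "T = c\<^sup>2 / 4 * t"
  define K where "K = - c\<^sup>2 / (2 * q\<^sub>0 x)"
  define B where "B = (\<lambda>s \<omega>. (- c / 2) * W (s / (- c / 2)\<^sup>2) \<omega>)"
  define A where "A = (\<lambda>(V :: real \<Rightarrow> 'a \<Rightarrow> real) \<omega>. LBINT s:{0..T}. exp (2 * V s \<omega>))"
  have B: "standard_brownian_motion M B"
    unfolding B_def using c by (intro brownian_scaling W.standard_brownian_motion_axioms) auto
  \<comment> \<open>The amplitude \<open>- c / 2\<close> makes \<open>2 * B\<close> a time change of \<open>- c * W\<close>, by the factor \<open>c\<^sup>2 / 4\<close>.\<close>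
  have AB: "A B \<omega> = c\<^sup>2 / 4 * (LBINT s:{0..t}. exp (- c * W s \<omega>))" for \<omega>
  proof -
    have "A B \<omega> = (LBINT s:{0..c\<^sup>2 / 4 * t}. exp (- c * W (s / (c\<^sup>2 / 4)) \<omega>))"
      by (simp add: A_def B_def T_def power_divide)
    also have "\<dots> = c\<^sup>2 / 4 * (LBINT s:{0..t}. exp (- c * W s \<omega>))"
      using c by (intro set_integral_rescale) simp
    finally show ?thesis .
  qed
  have breaking: "ereal t \<le> wave_breaking_time q\<^sub>0 c W x \<omega> \<longleftrightarrow> A B \<omega> \<le> K" if "\<omega> \<in> space M" for \<omega>
  proof -
    have "(LBINT s:{0..t}. exp (- c * W s \<omega>)) \<le> - 2 / q\<^sub>0 x \<longleftrightarrow>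
        c\<^sup>2 / 4 * (LBINT s:{0..t}. exp (- c * W s \<omega>)) \<le> c\<^sup>2 / 4 * (- 2 / q\<^sub>0 x)"
      using c by (intro mult_le_cancel_left_pos[symmetric]) simp
    moreover have "c\<^sup>2 / 4 * (- 2 / q\<^sub>0 x) = K"
      by (simp add: K_def)
    ultimately show ?thesis
      using wave_breaking_time_ge_iff[of W \<omega> q\<^sub>0 x t c, OF W.continuous_paths[OF that]]
        \<open>q\<^sub>0 x < 0\<close> \<open>0 \<le> t\<close> AB
      by metis
  qed
  have AW: "exp_functional W 0 (c\<^sup>2 * t / 4) \<omega> = A W \<omega>" for \<omega>
    by (simp add: exp_functional_def A_def T_def)
  have "measure M {\<omega> \<in> space M. A B \<omega> \<le> K} = measure M {\<omega> \<in> space M. A W \<omega> \<le> K}"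
  proof (cases "t = 0")
    \<comment> \<open>At \<open>t = 0\<close> the partitions degenerate, but both integrals vanish.\<close>
    case True
    then show ?thesis
      by (simp add: A_def T_def set_integral_singleton del: atLeastAtMost_singleton)
  next
    case False
    then have T: "0 < T" using c \<open>0 \<le> t\<close> by (simp add: T_def)
    have f: "continuous_on UNIV (\<lambda>y :: real. exp (2 * y))" by (intro continuous_intros)
    have law: "measure M {\<omega> \<in> space M. A V \<omega> \<le> K} = measure (distr M borel (A V)) {..K}"
      if "standard_brownian_motion M V" for V
    proof -
      have "A V \<in> borel_measurable M"
        unfolding A_def by (rule standard_brownian_motion.time_integral_measurable[OF that f T])
      then show ?thesis
        by (subst measure_distr) (auto intro!: arg_cong[where f = "measure M"])
    qed
    have "distr M borel (A B) = distr M borel (A W)"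
      unfolding A_def by (rule time_integral_law[OF B W.standard_brownian_motion_axioms f T])
    then show ?thesis
      using law[OF B] law[OF W.standard_brownian_motion_axioms] by simp
  qed
  moreover have "{\<omega> \<in> space M. ereal t \<le> wave_breaking_time q\<^sub>0 c W x \<omega>}
      = {\<omega> \<in> space M. A B \<omega> \<le> K}"
    using breaking by blast
  ultimately show ?thesis
    unfolding AW K_def[symmetric] by simp
qed

end
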